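(* Let $(\Omega,\mathcal A,P)$ be a probability space, $m\ge1$ an integer, $b_i,c_i,k_i>0$ for $i=1,\dots,m$, $0<a<1$, $e>0$, and let $r,S:\Omega\to\mathbb R$ be random variables with $0<\underline s<S(\omega)<\overline s$ for all $\omega\in\Omega$, for some constants $\underline s,\overline s$. For $\omega\in\Omega$ and $q=(q_1,\dots,q_m)\in\mathbb R^m_+$, with $Q=\sum_{j=1}^m q_j$, define $F(\omega,q)=(F_1(\omega,q),\dots,F_m(\omega,q))$ by $$F_i(\omega,q)=c_i+r(\omega)+k_i^{-1/b_i}q_i^{1/b_i}+a\,[S(\omega)]^a\frac{q_i}{(Q+e)^{a+1}}-\frac{[S(\omega)]^a}{(Q+e)^a},\qquad i=1,\dots,m.$$ Then, for all $\omega\in\Omega$ and all values of the parameters $b_i,c_i,k_i>0$ ($i=1,\dots,m$), $0<a<1$ and $e>0$, $F(\omega,\cdot)$ is strictly monotone in $\mathbb R^m_+$.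
   Context: $\mathbb R^m_+=\{q\in\mathbb R^m: q_i\ge0,\ i=1,\dots,m\}$. Strict monotonicity of $F(\omega,\cdot)$ in $\mathbb R^m_+$ means that for all $q,q'\in\mathbb R^m_+$, $\sum_{i=1}^m (F_i(\omega,q)-F_i(\omega,q'))(q_i-q_i')\ge0$, with equality only if $q=q'$. *)

theory Defs
  imports "HOL-Probability.Probability"
begin

definition nonneg_orthant :: "(real ^ 'm::finite) set" where
  "nonneg_orthant = {q. \<forall>i. 0 \<le> q $ i}"

definition strictly_monotone_on ::
    "(real ^ 'm::finite) set \<Rightarrow> (real ^ 'm \<Rightarrow> real ^ 'm) \<Rightarrow> bool" where
  "strictly_monotone_on K T \<longleftrightarrow>
     (\<forall>q\<in>K. \<forall>q'\<in>K.
        (\<Sum>i\<in>UNIV. (T q $ i - T q' $ i) * (q $ i - q' $ i)) \<ge> 0 \<and>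
        ((\<Sum>i\<in>UNIV. (T q $ i - T q' $ i) * (q $ i - q' $ i)) = 0 \<longrightarrow> q = q'))"

text \<open>The exponents are real, so powers are written with \<open>powr\<close>. On the nonnegative
  orthant this is the usual power: the base \<open>q $ i\<close> may vanish, where \<open>0 powr x = 0\<close> agrees with
  the usual value for the positive exponent \<open>1 / b i\<close>; all other bases are positive under the
  assumptions on the parameters.\<close>

definition operator_F ::
    "('m::finite \<Rightarrow> real) \<Rightarrow> ('m \<Rightarrow> real) \<Rightarrow> ('m \<Rightarrow> real) \<Rightarrow> real \<Rightarrow> real \<Rightarrow>
     ('w \<Rightarrow> real) \<Rightarrow> ('w \<Rightarrow> real) \<Rightarrow> 'w \<Rightarrow> real ^ 'm \<Rightarrow> real ^ 'm" where
  "operator_F b c k a e r S \<omega> q =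
     (let Q = (\<Sum>j\<in>UNIV. q $ j) in
      (\<chi> i. c i + r \<omega> + k i powr (- (1 / b i)) * (q $ i) powr (1 / b i)
           + a * (S \<omega>) powr a * (q $ i / (Q + e) powr (a + 1))
           - (S \<omega>) powr a / (Q + e) powr a))"

end

theory Submission imports Defs begin

text \<open>Up to the constant \<open>c i + r \<omega>\<close>, the operator is the sum of a separable part, strictly monotone
  because each power function is strictly increasing, and of \<open>S \<omega> powr a\<close> times a revenue part.
  At a point \<open>q\<close> with total \<open>Q\<close>, and for a direction \<open>d\<close> with coordinate sum \<open>D\<close>, the
  quadratic form of the Jacobian of the revenue part is
  \<open>a (Q + e) powr (- a - 2)\<close> times \<open>(\<bar>d\<bar>\<^sup>2 + D\<^sup>2) (Q + e) - (a + 1) (q \<bullet> d) D\<close>.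
  As \<open>q\<close> is nonnegative, \<open>\<bar>q \<bullet> d\<bar> \<le> \<bar>q\<bar> \<bar>d\<bar> \<le> Q \<bar>d\<bar>\<close>, and \<open>a + 1 \<le> 2\<close>, so the form is
  nonnegative by \<open>2 \<bar>d\<bar> \<bar>D\<bar> \<le> \<bar>d\<bar>\<^sup>2 + D\<^sup>2\<close>. Integrating along segments gives monotonicity.\<close>

lemma convex_nonneg_orthant: "convex nonneg_orthant"
  by (auto simp: convex_def nonneg_orthant_def)

lemma norm_le_sum_nonneg_orthant:
  assumes "q \<in> nonneg_orthant"
  shows "norm q \<le> (\<Sum>i\<in>UNIV. q $ i)"
  using norm_le_l1_cart[of q] assms by (simp add: nonneg_orthant_def)

lemma revenue_form_nonneg:
  fixes q d :: "real ^ 'm::finite" and a e D :: real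
  assumes q: "q \<in> nonneg_orthant" and a: "0 < a" "a \<le> 1" and e: "0 \<le> e"
  shows "(a + 1) * (q \<bullet> d) * D \<le> ((norm d)\<^sup>2 + D\<^sup>2) * ((\<Sum>i\<in>UNIV. q $ i) + e)"
proof -
  let ?Q = "\<Sum>i\<in>UNIV. q $ i"
  have Q: "norm q \<le> ?Q"
    by (rule norm_le_sum_nonneg_orthant[OF q])
  have "(a + 1) * (q \<bullet> d) * D \<le> (a + 1) * \<bar>q \<bullet> d\<bar> * \<bar>D\<bar>"
    using a abs_ge_self[of "(a + 1) * (q \<bullet> d) * D"] by (simp add: abs_mult)
  also have "\<dots> \<le> 2 * (?Q * norm d) * \<bar>D\<bar>"
  proof -
    have "\<bar>q \<bullet> d\<bar> \<le> ?Q * norm d"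
      using Cauchy_Schwarz_ineq2[of q d] mult_right_mono[OF Q norm_ge_zero[of d]] by linarith
    then show ?thesis
      using a by (intro mult_right_mono mult_mono) auto
  qed
  also have "\<dots> = ?Q * (2 * norm d * \<bar>D\<bar>)"
    by simp
  also have "\<dots> \<le> ?Q * ((norm d)\<^sup>2 + D\<^sup>2)"
    using sum_squares_bound[of "norm d" "\<bar>D\<bar>"] order_trans[OF norm_ge_zero Q]
    by (intro mult_left_mono) auto
  also have "\<dots> \<le> (?Q + e) * ((norm d)\<^sup>2 + D\<^sup>2)"
    using e by (intro mult_right_mono) auto
  finally show ?thesis
    by (simp add: mult.commute)
qed

lemma revenue_part_monotone:
  fixes q q' :: "real ^ 'm::finite" and a e :: real
  assumes q: "q \<in> nonneg_orthant" and q': "q' \<in> nonneg_orthant"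
    and a: "0 < a" "a \<le> 1" and e: "0 < e"
  defines "G \<equiv> \<lambda>x i. a * (x $ i / ((\<Sum>j\<in>UNIV. x $ j) + e) powr (a + 1))
                        - 1 / ((\<Sum>j\<in>UNIV. x $ j) + e) powr a"
  shows "0 \<le> (\<Sum>i\<in>UNIV. (G q i - G q' i) * (q $ i - q' $ i))"
proof -
  define d where "d = q - q'"
  define D where "D = (\<Sum>i\<in>UNIV. d $ i)"
  define R where "R = (\<lambda>t. (\<Sum>i\<in>UNIV. (q' + t *\<^sub>R d) $ i) + e)"
  define N where "N = (\<lambda>t. (q' + t *\<^sub>R d) \<bullet> d)"
  \<comment> \<open>\<open>\<phi> t\<close> is the revenue part at \<open>q' + t *\<^sub>R d\<close>
    paired with \<open>d\<close>; negative exponents in place of quotients suit the power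
    rule.\<close>
  define \<phi> where "\<phi> = (\<lambda>t. a * N t * R t powr (- (a + 1)) - D * R t powr (- a))"
  have G_inner: "(\<Sum>i\<in>UNIV. G (q' + t *\<^sub>R d) i * d $ i) = \<phi> t" for t
  proof -
    \<comment> \<open>With the two powers abstracted to \<open>A\<close> and \<open>B\<close>, only
      linearity in the coordinates is left.\<close>
    have "(\<Sum>i\<in>UNIV. (a * (x $ i / A) - 1 / B) * d $ i) = a * (x \<bullet> d) / A - D / B"
      for x and A B :: real
      by (simp add: D_def inner_vec_def sum_subtractf sum_distrib_left sum_divide_distrib
          left_diff_distrib mult.assoc)
    then show ?thesis
      unfolding G_def \<phi>_def N_def R_def powr_minus by (simp only: divide_inverse)
  qed
  have segment: "q' + t *\<^sub>R d \<in> nonneg_orthant" if "0 \<le> t" "t \<le> 1" for t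
    using convexD[OF convex_nonneg_orthant q' q, of "1 - t" t] that
    by (simp add: d_def algebra_simps)
  \<comment> \<open>Totals on the segment are nonnegative, so \<open>e\<close> keeps the base of
    \<open>powr\<close> positive, as differentiating it requires.\<close>
  have R_pos: "0 < R t" if "0 \<le> t" "t \<le> 1" for t
    using norm_le_sum_nonneg_orthant[OF segment[OF that]] norm_ge_zero[of "q' + t *\<^sub>R d"] e
    unfolding R_def by linarith
  have R_deriv: "(R has_real_derivative D) (at t)" for t
    unfolding R_def D_def by (auto intro!: derivative_eq_intros)
  have N_deriv: "(N has_real_derivative (norm d)\<^sup>2) (at t)" for t
    unfolding N_def by (auto intro!: derivative_eq_intros simp: inner_add_left power2_norm_eq_inner)
  have "\<phi> 0 \<le> \<phi> 1"
  proof (rule DERIV_nonneg_imp_nondecreasing[where f = \<phi>])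
    fix t :: real
    assume t: "0 \<le> t" "t \<le> 1"
    \<comment> \<open>The quadratic form of the Jacobian in the direction \<open>d\<close>, with the
      lowest power of \<open>R t\<close> factored out.\<close>
    let ?\<delta> = "a * R t powr (- a - 2) * (((norm d)\<^sup>2 + D\<^sup>2) * R t - (a + 1) * N t * D)"
    \<comment> \<open>Passing to the common exponent \<open>- a - 2\<close> releases the factor
      \<open>R t\<close> beside the squares in \<open>?\<delta>\<close>.\<close>
    have R_powr: "R t powr (- a - 1) = R t powr (- a - 2) * R t"
      using R_pos[OF t] powr_add[of "R t" "- a - 2" 1] by (simp add: minus_diff_commute)
    have powr_deriv: "((\<lambda>t. R t powr p) has_real_derivative p * R t powr (p - 1) * D) (at t)" for p
      using DERIV_fun_powr[OF R_deriv R_pos[OF t], of p] by simp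
    have exponent: "- (a + 1) - 1 = - a - 2"
      by simp
    have "(\<phi> has_real_derivative
        a * (norm d)\<^sup>2 * R t powr (- (a + 1)) + - (a + 1) * R t powr (- (a + 1) - 1) * D * (a * N t)
        - D * (- a * R t powr (- a - 1) * D)) (at t)"
      unfolding \<phi>_def
      by (intro DERIV_diff DERIV_mult DERIV_cmult N_deriv powr_deriv)
    then have "(\<phi> has_real_derivative ?\<delta>) (at t)"
      unfolding exponent minus_add_distrib diff_conv_add_uminus[symmetric] R_powr
      by (rule DERIV_cong) (simp add: algebra_simps power2_eq_square)
    moreover have "0 \<le> ?\<delta>"
      using revenue_form_nonneg[OF segment[OF t] a, of e d D] a e
      by (simp add: R_def N_def)
    ultimately show "\<exists>y. (\<phi> has_real_derivative y) (at t) \<and> 0 \<le> y"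
      by blast
  qed simp
  \<comment> \<open>The segment ends at \<open>q\<close> for \<open>t = 1\<close> and starts at
    \<open>q'\<close> for \<open>t = 0\<close>.\<close>
  moreover have "(\<Sum>i\<in>UNIV. (G q i - G q' i) * (q $ i - q' $ i)) = \<phi> 1 - \<phi> 0"
    using G_inner[of 1] G_inner[of 0]
    by (simp add: d_def left_diff_distrib sum_subtractf)
  ultimately show ?thesis
    by simp
qed

text \<open>Both factors have the same sign, \<open>powr\<close> with exponent \<open>p\<close>
  being strictly increasing from the base 0 on.\<close>

lemma powr_diff_mult_diff_pos:
  fixes x y p :: real
  assumes "0 \<le> x" "0 \<le> y" "0 < p" "x \<noteq> y"
  shows "0 < (x powr p - y powr p) * (x - y)"
  using assms powr_less_mono2[of p x y] powr_less_mono2[of p y x]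
  by (cases x y rule: linorder_cases) (auto intro: mult_pos_pos mult_neg_neg)

lemma operator_F_strictly_monotone:
  fixes b c k :: "'m::finite \<Rightarrow> real" and a e :: real and r S :: "'w \<Rightarrow> real"
  assumes b: "\<And>i. 0 < b i" and k: "\<And>i. 0 < k i"
    and a: "0 < a" "a \<le> 1" and e: "0 < e"
  shows "strictly_monotone_on nonneg_orthant (operator_F b c k a e r S \<omega>)"
proof -
  define H where "H = (\<lambda>q q' :: real ^ 'm. \<lambda>i.
    k i powr (- (1 / b i)) * (((q $ i) powr (1 / b i) - (q' $ i) powr (1 / b i)) * (q $ i - q' $ i)))"
  define G where "G = (\<lambda>x :: real ^ 'm. \<lambda>i.
    a * (x $ i / ((\<Sum>j\<in>UNIV. x $ j) + e) powr (a + 1)) - 1 / ((\<Sum>j\<in>UNIV. x $ j) + e) powr a)"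
  let ?F = "operator_F b c k a e r S \<omega>"
  \<comment> \<open>The constants \<open>c i + r \<omega>\<close> cancel in the differences.\<close>
  have split: "(\<Sum>i\<in>UNIV. (?F q $ i - ?F q' $ i) * (q $ i - q' $ i))
    = (\<Sum>i\<in>UNIV. H q q' i) + S \<omega> powr a * (\<Sum>i\<in>UNIV. (G q i - G q' i) * (q $ i - q' $ i))"
    for q q'
    unfolding sum_distrib_left sum.distrib[symmetric]
    by (rule sum.cong) (simp_all add: operator_F_def Let_def H_def G_def algebra_simps)
  \<comment> \<open>\<open>powr\<close> is nonnegative at every real base, so the factor
    \<open>S \<omega> powr a\<close> preserves the sign.\<close>
  have G: "0 \<le> S \<omega> powr a * (\<Sum>i\<in>UNIV. (G q i - G q' i) * (q $ i - q' $ i))"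
    if "q \<in> nonneg_orthant" "q' \<in> nonneg_orthant" for q q'
    unfolding G_def by (intro mult_nonneg_nonneg revenue_part_monotone that a e) simp
  have H_pos: "0 < H q q' i"
    if "q \<in> nonneg_orthant" "q' \<in> nonneg_orthant" "q $ i \<noteq> q' $ i" for q q' i
    unfolding H_def using that b[of i] k[of i]
    by (intro mult_pos_pos powr_diff_mult_diff_pos) (auto simp: nonneg_orthant_def)
  have H_nonneg: "0 \<le> H q q' i"
    if "q \<in> nonneg_orthant" "q' \<in> nonneg_orthant" for q q' i
    using H_pos[OF that, of i] by (cases "q $ i = q' $ i") (auto simp: H_def)
  \<comment> \<open>One differing coordinate suffices: its summand is positive and the others are
    nonnegative.\<close>
  have "0 < (\<Sum>i\<in>UNIV. H q q' i)"
    if "q \<in> nonneg_orthant" "q' \<in> nonneg_orthant" "q \<noteq> q'" for q q'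
  proof -
    obtain i where "q $ i \<noteq> q' $ i"
      using \<open>q \<noteq> q'\<close> by (auto simp: vec_eq_iff)
    then show ?thesis
      using H_pos H_nonneg that by (intro sum_pos2[of UNIV i]) auto
  qed
  then have "0 < (\<Sum>i\<in>UNIV. (?F q $ i - ?F q' $ i) * (q $ i - q' $ i))"
    if "q \<in> nonneg_orthant" "q' \<in> nonneg_orthant" "q \<noteq> q'" for q q'
    unfolding split using G that by (intro add_pos_nonneg) auto
  then have "0 \<le> (\<Sum>i\<in>UNIV. (?F q $ i - ?F q' $ i) * (q $ i - q' $ i)) \<and>
      ((\<Sum>i\<in>UNIV. (?F q $ i - ?F q' $ i) * (q $ i - q' $ i)) = 0 \<longrightarrow> q = q')"
    if "q \<in> nonneg_orthant" "q' \<in> nonneg_orthant" for q q'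
    using that by (cases "q = q'") (simp, fastforce)
  then show ?thesis
    unfolding strictly_monotone_on_def by blast
qed

theorem theorem6p1:
  fixes M :: "'w measure"
    and b c k :: "'m::finite \<Rightarrow> real"
    and a e s_lo s_hi :: real
    and r S :: "'w \<Rightarrow> real"
  assumes "prob_space M"
    and "\<And>i. 0 < b i" and "\<And>i. 0 < c i" and "\<And>i. 0 < k i"
    and "0 < a" and "a < 1" and "0 < e"
    and "r \<in> borel_measurable M" and "S \<in> borel_measurable M"
    and "0 < s_lo"
    and "\<And>\<omega>. \<omega> \<in> space M \<Longrightarrow> s_lo < S \<omega> \<and> S \<omega> < s_hi"
  shows "\<forall>\<omega>\<in>space M. strictly_monotone_on nonneg_orthant (operator_F b c k a e r S \<omega>)"
  using assms by (intro ballI operator_F_strictly_monotone) auto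

end
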